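(* Let $E_1,\dots,E_m$ and $F$ be Banach spaces. If $E_i$ has the Schur property for all $i=1,\dots,m$, then every continuous multilinear mapping from $E_1\times\cdots\times E_m$ into $F$ is weakly Dunford–Pettis at every point. In particular, $\mathcal{L}_{WDP}^{\mathrm{ev}}(E_1,\dots,E_m;F)=\mathcal{L}(E_1,\dots,E_m;F)$.
   Context: Banach spaces are over $\mathbb{K}=\mathbb{R}$ or $\mathbb{C}$; $F'$ is the topological dual of $F$; $\overset{w}{\to}$ denotes weak convergence of sequences (in $F'$ this means $\sigma(F',F'')$); $\mathcal{L}(E_1,\dots,E_m;F)$ is the space of continuous $m$-linear operators. A Banach space has the Schur property if every weakly convergent sequence in it converges in norm. $T\in\mathcal{L}(E_1,\dots,E_m;F)$ is weakly Dunford–Pettis at every point, $T\in\mathcal{L}_{WDP}^{\mathrm{ev}}(E_1,\dots,E_m;F)$, if for all $(a_1,\dots,a_m)\in E_1\times\cdots\times E_m$, all sequences $x_j^{(i)}\overset{w}{\to}a_i$ in $E_i$ ($i=1,\dots,m$), and all sequences $f_j\overset{w}{\to}f$ in $F'$ with $f\in F'$, one has $f_j(T(x_j^{(1)},\dots,x_j^{(m)}))\to f(T(a_1,\dots,a_m))$. *)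

theory Defs
  imports "HOL-Analysis.Analysis" "HOL-Algebra.Module" "HOL-Algebra.Algebraic_Closure_Type"
begin

text \<open>
  The scalar field is a type of class \<^class>\<open>real_normed_field\<close>. Its norm is multiplicative, so by
  the Gelfand--Mazur theorem such a type is isometrically isomorphic to the real or to the complex
  numbers; both are instances.

  Vector spaces are modules (in the sense of HOL-Algebra) over the scalars, with an explicit
  carrier, so that one can speak of a family of different spaces indexed by numbers and of
  the dual of a space as a space of the same kind. As everywhere in HOL-Algebra, the record
  inherits the fields \<^const>\<open>mult\<close> and \<^const>\<open>one\<close>; for a module they carry no meaning.
\<close>

record ('k, 'a) nspace = "('k, 'a) module" +
  vnorm :: "'a \<Rightarrow> real"

locale normed_space =
  Module.module "ring_of_type_algebra :: 'k ring" E
  for E :: "('k::real_normed_field, 'a) nspace" (structure) +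
  assumes vnorm_nonneg: "x \<in> carrier E \<Longrightarrow> 0 \<le> vnorm E x"
    and vnorm_eq_zero_iff: "x \<in> carrier E \<Longrightarrow> vnorm E x = 0 \<longleftrightarrow> x = \<zero>"
    and vnorm_smult: "x \<in> carrier E \<Longrightarrow> vnorm E (c \<odot> x) = norm c * vnorm E x"
    and vnorm_triangle:
      "\<lbrakk>x \<in> carrier E; y \<in> carrier E\<rbrakk> \<Longrightarrow> vnorm E (x \<oplus> y) \<le> vnorm E x + vnorm E y"

text \<open>
  The metric induced by the norm. The value off the carrier only serves the axioms of
  \<^locale>\<open>Metric_space\<close>, which ask for nonnegativity and symmetry on the whole type.
\<close>

definition vdist :: "('k, 'a) nspace \<Rightarrow> 'a \<Rightarrow> 'a \<Rightarrow> real" where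
  "vdist E x y =
     (if x \<in> carrier E \<and> y \<in> carrier E then vnorm E (x \<ominus>\<^bsub>E\<^esub> y) else 0)"

lemma (in normed_space) vnorm_minus_commute:
  assumes "x \<in> carrier E" "y \<in> carrier E"
  shows "vnorm E (x \<ominus> y) = vnorm E (y \<ominus> x)"
proof -
  have one: "(1::'k) \<in> carrier ring_of_type_algebra" "(-1::'k) \<in> carrier ring_of_type_algebra"
    by (simp_all add: ring_of_type_algebra_def)
  have z: "z \<oplus> (-1) \<odot> z = \<zero>" if "z \<in> carrier E" for z
  proof -
    have "z \<oplus> (-1) \<odot> z = (1::'k) \<odot> z \<oplus> (-1) \<odot> z"
      using smult_one[OF that] by (simp add: ring_of_type_algebra_def)
    also have "\<dots> = (0::'k) \<odot> z"
      using smult_l_distr[OF one that] by (simp add: ring_of_type_algebra_def)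
    also have "\<dots> = \<zero>"
      using smult_l_null[OF that] by (simp add: ring_of_type_algebra_def)
    finally show ?thesis .
  qed
  have "\<ominus> (x \<ominus> y) = (-1) \<odot> (x \<ominus> y)"
    using assms z[of "x \<ominus> y"] smult_closed[OF one(2), of "x \<ominus> y"]
    by (metis M.minus_closed M.minus_equality M.a_comm)
  moreover have "\<ominus> (x \<ominus> y) = y \<ominus> x"
    using assms by (simp add: M.minus_eq M.minus_add M.a_comm)
  ultimately show ?thesis
    using vnorm_smult[of "x \<ominus> y" "-1"] assms by simp
qed

sublocale normed_space \<subseteq> metric: Metric_space "carrier E" "vdist E"
proof
  fix x y z
  show "0 \<le> vdist E x y"
    by (simp add: vdist_def vnorm_nonneg)
  show "vdist E x y = vdist E y x"
    by (simp add: vdist_def vnorm_minus_commute)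
  show "vdist E x y = 0 \<longleftrightarrow> x = y" if "x \<in> carrier E" "y \<in> carrier E"
  proof -
    have "x \<ominus> y = \<zero> \<longleftrightarrow> x = y"
      using that by (metis M.minus_eq M.r_neg M.minus_equality M.minus_minus M.a_inv_closed)
    then show ?thesis
      using that by (simp add: vdist_def vnorm_eq_zero_iff)
  qed
  show "vdist E x z \<le> vdist E x y + vdist E y z"
    if "x \<in> carrier E" "y \<in> carrier E" "z \<in> carrier E"
  proof -
    have "(x \<ominus> y) \<oplus> (y \<ominus> z) = x \<oplus> ((\<ominus> y \<oplus> y) \<oplus> \<ominus> z)"
      using that by (simp add: M.minus_eq M.a_assoc)
    then have "(x \<ominus> y) \<oplus> (y \<ominus> z) = x \<ominus> z"
      using that by (simp add: M.minus_eq M.l_neg)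
    then show ?thesis
      using that vnorm_triangle[of "x \<ominus> y" "y \<ominus> z"] by (simp add: vdist_def)
  qed
qed

locale Banach_space = normed_space +
  assumes complete: "metric.mcomplete"

definition norm_topology :: "('k, 'a) nspace \<Rightarrow> 'a topology" where
  "norm_topology E = Metric_space.mtopology (carrier E) (vdist E)"

text \<open>
  Operators are extensional, so that they are determined by their values on the carrier.
\<close>

definition dual :: "('k::real_normed_field, 'a) nspace \<Rightarrow> ('k, 'a \<Rightarrow> 'k) nspace" where
  "dual E =
    \<lparr>carrier = {\<phi> \<in> extensional (carrier E).
       (\<forall>x\<in>carrier E. \<forall>y\<in>carrier E. \<phi> (x \<oplus>\<^bsub>E\<^esub> y) = \<phi> x + \<phi> y) \<and>
       (\<forall>c. \<forall>x\<in>carrier E. \<phi> (c \<odot>\<^bsub>E\<^esub> x) = c * \<phi> x) \<and>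
       continuous_map (norm_topology E) euclidean \<phi>},
     mult = undefined,
     one = undefined,
     zero = (\<lambda>x\<in>carrier E. 0),
     add = (\<lambda>\<phi> \<psi>. \<lambda>x\<in>carrier E. \<phi> x + \<psi> x),
     smult = (\<lambda>c \<phi>. \<lambda>x\<in>carrier E. c * \<phi> x),
     vnorm = (\<lambda>\<phi>. SUP x\<in>{x \<in> carrier E. vnorm E x \<le> 1}. norm (\<phi> x))\<rparr>"

definition weakly_converges ::
    "('k::real_normed_field, 'a) nspace \<Rightarrow> (nat \<Rightarrow> 'a) \<Rightarrow> 'a \<Rightarrow> bool" where
  "weakly_converges E x a \<longleftrightarrow>
     (\<forall>j. x j \<in> carrier E) \<and> a \<in> carrier E \<and>
     (\<forall>\<phi>\<in>carrier (dual E). (\<lambda>j. \<phi> (x j)) \<longlonglongrightarrow> \<phi> a)"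

definition Schur_property :: "('k::real_normed_field, 'a) nspace \<Rightarrow> bool" where
  "Schur_property E \<longleftrightarrow>
     (\<forall>x. (\<exists>a. weakly_converges E x a) \<longrightarrow>
          (\<exists>b\<in>carrier E. (\<lambda>j. vnorm E (x j \<ominus>\<^bsub>E\<^esub> b)) \<longlonglongrightarrow> 0))"

text \<open>
  An element of \<open>E\<^sub>1 \<times> \<dots> \<times> E\<^sub>m\<close> is an extensional function on \<open>{1..m}\<close>.
\<close>

definition multilinear_maps ::
    "nat \<Rightarrow> (nat \<Rightarrow> ('k::real_normed_field, 'a) nspace) \<Rightarrow> ('k, 'b) nspace \<Rightarrow> ((nat \<Rightarrow> 'a) \<Rightarrow> 'b) set"
  where
  "multilinear_maps m E F =
     {T \<in> (\<Pi>\<^sub>E i\<in>{1..m}. carrier (E i)) \<rightarrow>\<^sub>E carrier F.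
        \<forall>x \<in> \<Pi>\<^sub>E i\<in>{1..m}. carrier (E i). \<forall>i\<in>{1..m}.
          (\<forall>u\<in>carrier (E i). \<forall>v\<in>carrier (E i).
             T (x(i := u \<oplus>\<^bsub>E i\<^esub> v)) = T (x(i := u)) \<oplus>\<^bsub>F\<^esub> T (x(i := v))) \<and>
          (\<forall>c. \<forall>u\<in>carrier (E i). T (x(i := c \<odot>\<^bsub>E i\<^esub> u)) = c \<odot>\<^bsub>F\<^esub> T (x(i := u)))}"

definition continuous_multilinear_maps ::
    "nat \<Rightarrow> (nat \<Rightarrow> ('k::real_normed_field, 'a) nspace) \<Rightarrow> ('k, 'b) nspace \<Rightarrow> ((nat \<Rightarrow> 'a) \<Rightarrow> 'b) set"
  where
  "continuous_multilinear_maps m E F =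
     {T \<in> multilinear_maps m E F.
        continuous_map (product_topology (\<lambda>i. norm_topology (E i)) {1..m}) (norm_topology F) T}"

definition WDP_at_every_point ::
    "nat \<Rightarrow> (nat \<Rightarrow> ('k::real_normed_field, 'a) nspace) \<Rightarrow> ('k, 'b) nspace \<Rightarrow> ((nat \<Rightarrow> 'a) \<Rightarrow> 'b) \<Rightarrow> bool"
  where
  "WDP_at_every_point m E F T \<longleftrightarrow>
     (\<forall>a \<in> \<Pi>\<^sub>E i\<in>{1..m}. carrier (E i). \<forall>x f \<phi>.
        (\<forall>i\<in>{1..m}. weakly_converges (E i) (x i) (a i)) \<longrightarrow>
        weakly_converges (dual F) f \<phi> \<longrightarrow>
        (\<lambda>j. f j (T (\<lambda>i\<in>{1..m}. x i j))) \<longlonglongrightarrow> \<phi> (T a))"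

definition WDP_ev ::
    "nat \<Rightarrow> (nat \<Rightarrow> ('k::real_normed_field, 'a) nspace) \<Rightarrow> ('k, 'b) nspace \<Rightarrow> ((nat \<Rightarrow> 'a) \<Rightarrow> 'b) set"
  where
  "WDP_ev m E F = {T \<in> continuous_multilinear_maps m E F. WDP_at_every_point m E F T}"

end

theory Submission
  imports Defs
begin

text \<open>
  Mixing a weakly convergent sequence with the constant sequence of its limit shows, without
  Hahn--Banach, that in a Schur space a weakly convergent sequence converges in norm to its weak
  limit. Hence \<open>T (x\<^sub>j) \<longlonglongrightarrow> T a\<close> in norm for every continuous \<open>T\<close>. A weakly convergent sequence in
  \<open>F'\<close> converges pointwise on \<open>F\<close>, so it is bounded by Banach--Steinhaus, and
  \<open>f\<^sub>j (T x\<^sub>j) - f (T a) = f\<^sub>j (T x\<^sub>j - T a) + (f\<^sub>j (T a) - f (T a))\<close> tends to 0.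
\<close>

section \<open>Linear functionals and the record of the dual\<close>

text \<open>The algebraic part of membership in \<open>dual E\<close>, kept apart from continuity so
  that continuity can be characterised by a norm bound.\<close>

definition linear_functional :: "('k::real_normed_field, 'a) nspace \<Rightarrow> ('a \<Rightarrow> 'k) \<Rightarrow> bool" where
  "linear_functional E \<phi> \<longleftrightarrow>
     (\<forall>x\<in>carrier E. \<forall>y\<in>carrier E. \<phi> (x \<oplus>\<^bsub>E\<^esub> y) = \<phi> x + \<phi> y) \<and>
     (\<forall>c. \<forall>x\<in>carrier E. \<phi> (c \<odot>\<^bsub>E\<^esub> x) = c * \<phi> x)"

lemma linear_functionalD:
  assumes "linear_functional E \<phi>"
  shows "\<lbrakk>x \<in> carrier E; y \<in> carrier E\<rbrakk> \<Longrightarrow> \<phi> (x \<oplus>\<^bsub>E\<^esub> y) = \<phi> x + \<phi> y"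
    and "x \<in> carrier E \<Longrightarrow> \<phi> (c \<odot>\<^bsub>E\<^esub> x) = c * \<phi> x"
  using assms by (auto simp: linear_functional_def)

lemma carrier_dual_iff:
  "\<phi> \<in> carrier (dual E) \<longleftrightarrow> \<phi> \<in> extensional (carrier E) \<and> linear_functional E \<phi> \<and>
     continuous_map (norm_topology E) euclidean \<phi>"
  by (auto simp: dual_def linear_functional_def)

lemma ring_of_type_algebra_simps [simp]:
  "carrier ring_of_type_algebra = UNIV" "mult ring_of_type_algebra = (*)"
  "one ring_of_type_algebra = 1" "zero ring_of_type_algebra = 0" "add ring_of_type_algebra = (+)"
  by (simp_all add: ring_of_type_algebra_def fun_eq_iff)

lemma dual_simps [simp]:
  "add (dual E) \<phi> \<psi> = (\<lambda>x\<in>carrier E. \<phi> x + \<psi> x)"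
  "smult (dual E) c \<phi> = (\<lambda>x\<in>carrier E. c * \<phi> x)"
  "zero (dual E) = (\<lambda>x\<in>carrier E. 0)"
  by (simp_all add: dual_def)

lemma vnorm_dual: "vnorm (dual E) \<phi> = (SUP x\<in>{x \<in> carrier E. vnorm E x \<le> 1}. norm (\<phi> x))"
  by (simp add: dual_def)

section \<open>Continuity and boundedness of functionals\<close>

context normed_space
begin

lemma scalar_mult_closed [simp]: "x \<in> carrier E \<Longrightarrow> c \<odot> x \<in> carrier E"
  by (rule smult_closed) simp_all

lemma uminus_eq_smult:
  assumes "x \<in> carrier E"
  shows "\<ominus> x = (-1) \<odot> x"
proof -
  have "(-1) \<odot> x \<oplus> x = (-1) \<odot> x \<oplus> 1 \<odot> x"
    using smult_one[OF assms] by simp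
  also have "\<dots> = \<zero>"
    using smult_l_distr[of "-1" 1 x] smult_l_null[OF assms] assms by simp
  finally show ?thesis
    using assms by (simp add: M.minus_equality)
qed

lemma linear_functional_diff:
  assumes "linear_functional E \<phi>" "x \<in> carrier E" "y \<in> carrier E"
  shows "\<phi> (x \<ominus> y) = \<phi> x - \<phi> y"
  using assms by (simp add: M.minus_eq uminus_eq_smult linear_functionalD)

lemma linear_functional_zero:
  assumes "linear_functional E \<phi>"
  shows "\<phi> \<zero> = 0"
  using linear_functionalD(1)[OF assms, of \<zero> \<zero>] by simp

lemma diff_zero_iff:
  assumes "x \<in> carrier E" "y \<in> carrier E"
  shows "vnorm E (x \<ominus> y) = 0 \<longleftrightarrow> x = y"
  using metric.zero[OF assms] assms by (simp add: vdist_def)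

lemma vnorm_zero [simp]: "vnorm E \<zero> = 0"
  by (simp add: vnorm_eq_zero_iff)

lemma vdist_zero_left: "x \<in> carrier E \<Longrightarrow> vdist E \<zero> x = vnorm E x"
  using metric.commute[of \<zero> x] by (simp add: vdist_def M.minus_eq uminus_eq_smult[of \<zero>])

text \<open>By homogeneity, a bound on a small open ball spreads to the whole space: a vector of
  nonzero norm is scaled into the ball and the scalar is divided out. This serves for continuity at
  zero, for the operator norm and for Banach-Steinhaus.\<close>

lemma linear_functional_bound:
  assumes \<phi>: "linear_functional E \<phi>" and "0 < r"
    and ball: "\<And>y. y \<in> carrier E \<Longrightarrow> vnorm E y < r \<Longrightarrow> norm (\<phi> y) \<le> K"
    and x: "x \<in> carrier E"
  shows "norm (\<phi> x) \<le> (2 * K / r) * vnorm E x"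
proof (cases "vnorm E x = 0")
  case True
  then show ?thesis
    using x \<phi> by (simp add: vnorm_eq_zero_iff linear_functional_zero)
next
  case False
  then have pos: "0 < vnorm E x"
    using vnorm_nonneg[OF x] by simp
  \<comment> \<open>The scaled vector gets norm \<open>r / 2\<close>, strictly inside the open ball;
    this is the source of the factor 2.\<close>
  define t where "t = r / (2 * vnorm E x)"
  have t: "0 < t" using pos \<open>0 < r\<close> by (simp add: t_def)
  have "vnorm E (of_real t \<odot> x) = r / 2"
    using pos t x by (simp add: vnorm_smult) (simp add: t_def)
  then have "norm (\<phi> (of_real t \<odot> x)) \<le> K"
    using \<open>0 < r\<close> x by (intro ball) auto
  then have "t * norm (\<phi> x) \<le> K"
    using linear_functionalD(2)[OF \<phi> x] t by (simp add: norm_mult)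
  then show ?thesis
    using pos \<open>0 < r\<close> by (simp add: t_def field_simps)
qed

text \<open>Continuity at zero already bounds the functional by 1 on some ball; conversely,
  linearity turns a norm bound into a Lipschitz estimate.\<close>

lemma continuous_linear_functional_iff:
  assumes \<phi>: "linear_functional E \<phi>"
  shows "continuous_map (norm_topology E) euclidean \<phi> \<longleftrightarrow>
    (\<exists>K. \<forall>x\<in>carrier E. norm (\<phi> x) \<le> K * vnorm E x)"
proof -
  have eq: "continuous_map (norm_topology E) euclidean \<phi> \<longleftrightarrow>
     (\<forall>a\<in>carrier E. \<forall>\<epsilon>>0. \<exists>\<delta>>0. \<forall>x. x \<in> carrier E \<and> vdist E a x < \<delta> \<longrightarrow> dist (\<phi> a) (\<phi> x) < \<epsilon>)"
    using metric.metric_continuous_map[OF Met_TC.Metric_space_axioms, of \<phi>]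
    by (simp add: norm_topology_def)
  show ?thesis
  proof
    assume "continuous_map (norm_topology E) euclidean \<phi>"
    then obtain \<delta> where "\<delta> > 0"
      and \<delta>: "\<And>x. x \<in> carrier E \<Longrightarrow> vdist E \<zero> x < \<delta> \<Longrightarrow> dist (\<phi> \<zero>) (\<phi> x) < 1"
      unfolding eq by (meson M.zero_closed zero_less_one)
    have "norm (\<phi> y) \<le> 1" if "y \<in> carrier E" "vnorm E y < \<delta>" for y
      using \<delta>[of y] that by (simp add: vdist_zero_left linear_functional_zero[OF \<phi>] less_imp_le)
    then show "\<exists>K. \<forall>x\<in>carrier E. norm (\<phi> x) \<le> K * vnorm E x"
      using linear_functional_bound[OF \<phi> \<open>\<delta> > 0\<close>] by blast
  next
    assume "\<exists>K. \<forall>x\<in>carrier E. norm (\<phi> x) \<le> K * vnorm E x"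
    then obtain K where K: "\<And>x. x \<in> carrier E \<Longrightarrow> norm (\<phi> x) \<le> K * vnorm E x"
      by blast
    have "dist (\<phi> a) (\<phi> x) < \<epsilon>"
      if "a \<in> carrier E" "x \<in> carrier E" "0 < \<epsilon>" "vdist E a x < \<epsilon> / (\<bar>K\<bar> + 1)" for a x \<epsilon>
    proof -
      have "dist (\<phi> a) (\<phi> x) \<le> K * vnorm E (a \<ominus> x)"
        using K[of "a \<ominus> x"] that by (simp add: dist_norm linear_functional_diff[OF \<phi>])
      \<comment> \<open>\<open>K\<close> may be negative or zero, while
        \<open>\<bar>K\<bar> + 1\<close> is always a legitimate divisor for \<delta>.\<close>
      also have "\<dots> \<le> (\<bar>K\<bar> + 1) * vdist E a x"
        using that by (simp add: vdist_def vnorm_nonneg mult_right_mono)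
      also have "\<dots> < \<epsilon>"
        using that(4) by (simp add: field_simps)
      finally show ?thesis .
    qed
    then show "continuous_map (norm_topology E) euclidean \<phi>"
      unfolding eq
      by (intro ballI allI impI exI[of _ "_ / (\<bar>K\<bar> + 1)"]) (auto intro!: divide_pos_pos)
  qed
qed

lemma carrier_dual_iff_bounded:
  "\<phi> \<in> carrier (dual E) \<longleftrightarrow> \<phi> \<in> extensional (carrier E) \<and> linear_functional E \<phi> \<and>
     (\<exists>K. \<forall>x\<in>carrier E. norm (\<phi> x) \<le> K * vnorm E x)"
  using carrier_dual_iff continuous_linear_functional_iff by blast

lemma dual_boundE:
  assumes "\<phi> \<in> carrier (dual E)"
  obtains K where "0 \<le> K" "\<And>x. x \<in> carrier E \<Longrightarrow> norm (\<phi> x) \<le> K * vnorm E x"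
proof -
  obtain K where K: "\<And>x. x \<in> carrier E \<Longrightarrow> norm (\<phi> x) \<le> K * vnorm E x"
    using assms by (auto simp: carrier_dual_iff_bounded)
  have "norm (\<phi> x) \<le> \<bar>K\<bar> * vnorm E x" if "x \<in> carrier E" for x
    using K[OF that] vnorm_nonneg[OF that] by (meson abs_ge_self mult_right_mono order_trans)
  then show ?thesis
    using that[of "\<bar>K\<bar>"] by simp
qed

section \<open>The operator norm\<close>

text \<open>The unit ball contains zero, so the supremum is taken over a nonempty set.\<close>

lemma vnorm_dual_le:
  assumes "\<And>x. x \<in> carrier E \<Longrightarrow> vnorm E x \<le> 1 \<Longrightarrow> norm (\<phi> x) \<le> K"
  shows "vnorm (dual E) \<phi> \<le> K"
  unfolding vnorm_dual using assms by (intro cSUP_least) (auto intro: exI[of _ \<zero>])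

lemma bdd_above_dual:
  assumes "\<phi> \<in> carrier (dual E)"
  shows "bdd_above ((\<lambda>x. norm (\<phi> x)) ` {x \<in> carrier E. vnorm E x \<le> 1})"
proof -
  obtain K where "0 \<le> K" and K: "\<And>x. x \<in> carrier E \<Longrightarrow> norm (\<phi> x) \<le> K * vnorm E x"
    using dual_boundE[OF assms] by blast
  have "norm (\<phi> x) \<le> K" if "x \<in> carrier E" "vnorm E x \<le> 1" for x
    using K[OF that(1)] mult_left_le[OF that(2) \<open>0 \<le> K\<close>] by simp
  then show ?thesis
    by (intro bdd_aboveI2) auto
qed

lemma vnorm_dual_upper:
  assumes "\<phi> \<in> carrier (dual E)" "x \<in> carrier E" "vnorm E x \<le> 1"
  shows "norm (\<phi> x) \<le> vnorm (dual E) \<phi>"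
  unfolding vnorm_dual using assms by (intro cSUP_upper bdd_above_dual) auto

text \<open>
  The factor 2 could be dropped; it is inherited from the open ball in \<open>linear_functional_bound\<close>.
\<close>

lemma norm_le_vnorm_dual:
  assumes \<phi>: "\<phi> \<in> carrier (dual E)" and x: "x \<in> carrier E"
  shows "norm (\<phi> x) \<le> 2 * vnorm (dual E) \<phi> * vnorm E x"
proof -
  have "linear_functional E \<phi>"
    using \<phi> by (simp add: carrier_dual_iff)
  from linear_functional_bound[OF this zero_less_one _ x] show ?thesis
    using vnorm_dual_upper[OF \<phi>] by simp
qed

section \<open>The dual as a normed space\<close>

lemma dual_add_closed:
  assumes "\<phi> \<in> carrier (dual E)" "\<psi> \<in> carrier (dual E)"
  shows "\<phi> \<oplus>\<^bsub>dual E\<^esub> \<psi> \<in> carrier (dual E)"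
proof -
  obtain K where "0 \<le> K" and K: "\<And>x. x \<in> carrier E \<Longrightarrow> norm (\<phi> x) \<le> K * vnorm E x"
    using dual_boundE[OF assms(1)] by blast
  obtain L where "0 \<le> L" and L: "\<And>x. x \<in> carrier E \<Longrightarrow> norm (\<psi> x) \<le> L * vnorm E x"
    using dual_boundE[OF assms(2)] by blast
  have "norm (\<phi> x + \<psi> x) \<le> (K + L) * vnorm E x" if "x \<in> carrier E" for x
    using norm_triangle_ineq[of "\<phi> x" "\<psi> x"] K[OF that] L[OF that] by (simp add: distrib_right)
  moreover have "linear_functional E (\<phi> \<oplus>\<^bsub>dual E\<^esub> \<psi>)"
    using assms by (auto simp: carrier_dual_iff linear_functional_def algebra_simps)
  ultimately show ?thesis
    by (auto simp: carrier_dual_iff_bounded)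
qed

lemma dual_smult_closed:
  assumes "\<phi> \<in> carrier (dual E)"
  shows "c \<odot>\<^bsub>dual E\<^esub> \<phi> \<in> carrier (dual E)"
proof -
  obtain K where "0 \<le> K" and K: "\<And>x. x \<in> carrier E \<Longrightarrow> norm (\<phi> x) \<le> K * vnorm E x"
    using dual_boundE[OF assms] by blast
  have "norm (c * \<phi> x) \<le> (norm c * K) * vnorm E x" if "x \<in> carrier E" for x
    using mult_left_mono[OF K[OF that], of "norm c"] by (simp add: norm_mult mult.assoc)
  moreover have "linear_functional E (c \<odot>\<^bsub>dual E\<^esub> \<phi>)"
    using assms by (auto simp: carrier_dual_iff linear_functional_def algebra_simps)
  ultimately show ?thesis
    by (auto simp: carrier_dual_iff_bounded)
qed

lemma dual_zero_closed: "\<zero>\<^bsub>dual E\<^esub> \<in> carrier (dual E)"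
  by (auto simp: carrier_dual_iff_bounded linear_functional_def intro: exI[of _ 0])

lemma dual_extensional: "\<phi> \<in> carrier (dual E) \<Longrightarrow> \<phi> \<in> extensional (carrier E)"
  by (simp add: carrier_dual_iff)

lemma abelian_group_dual: "abelian_group (dual E)"
proof (rule abelian_groupI)
  fix \<phi>
  assume \<phi>: "\<phi> \<in> carrier (dual E)"
  show "\<exists>\<psi>\<in>carrier (dual E). \<psi> \<oplus>\<^bsub>dual E\<^esub> \<phi> = \<zero>\<^bsub>dual E\<^esub>"
    using dual_smult_closed[OF \<phi>, of "-1"]
    by (intro bexI[of _ "(-1) \<odot>\<^bsub>dual E\<^esub> \<phi>"]) (auto simp: restrict_def)
  show "\<zero>\<^bsub>dual E\<^esub> \<oplus>\<^bsub>dual E\<^esub> \<phi> = \<phi>"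
    using dual_extensional[OF \<phi>] by (intro extensionalityI[where A = "carrier E"]) auto
qed (erule (1) dual_add_closed | rule dual_zero_closed | force simp: restrict_def add_ac)+

lemma module_dual: "Module.module (ring_of_type_algebra :: 'k ring) (dual E)"
proof (rule moduleI)
  fix \<phi>
  assume \<phi>: "\<phi> \<in> carrier (dual E)"
  show "\<one>\<^bsub>ring_of_type_algebra\<^esub> \<odot>\<^bsub>dual E\<^esub> \<phi> = \<phi>"
    using dual_extensional[OF \<phi>] by (intro extensionalityI[where A = "carrier E"]) auto
qed (rule cring_from_type_algebra abelian_group_dual | erule dual_smult_closed
    | force simp: restrict_def algebra_simps)+

text \<open>Makes every result of the locale available for \<open>dual E\<close>, in particular the
  description of the bidual by bounded functionals.\<close>

lemma normed_space_dual: "normed_space (dual E)"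
proof (intro normed_space.intro normed_space_axioms.intro module_dual)
  fix \<phi> \<psi> and c :: 'k
  assume \<phi>: "\<phi> \<in> carrier (dual E)"
  show nonneg: "0 \<le> vnorm (dual E) \<phi>"
    using order_trans[OF norm_ge_zero vnorm_dual_upper[OF \<phi>, of \<zero>]] by simp
  show "vnorm (dual E) \<phi> = 0 \<longleftrightarrow> \<phi> = \<zero>\<^bsub>dual E\<^esub>"
  proof
    assume "vnorm (dual E) \<phi> = 0"
    then have "\<phi> x = 0" if "x \<in> carrier E" for x
      using norm_le_vnorm_dual[OF \<phi> that] by simp
    then show "\<phi> = \<zero>\<^bsub>dual E\<^esub>"
      using dual_extensional[OF \<phi>] by (intro extensionalityI[where A = "carrier E"]) auto
  next
    assume "\<phi> = \<zero>\<^bsub>dual E\<^esub>"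
    then show "vnorm (dual E) \<phi> = 0"
      using nonneg by (intro antisym vnorm_dual_le) auto
  qed
  have le: "vnorm (dual E) (d \<odot>\<^bsub>dual E\<^esub> \<xi>) \<le> norm d * vnorm (dual E) \<xi>"
    if "\<xi> \<in> carrier (dual E)" for d \<xi>
    using vnorm_dual_upper[OF that] by (intro vnorm_dual_le) (simp add: norm_mult mult_left_mono)
  show "vnorm (dual E) (c \<odot>\<^bsub>dual E\<^esub> \<phi>) = norm c * vnorm (dual E) \<phi>"
  proof (rule antisym)
    \<comment> \<open>For nonzero \<open>c\<close> this is the inequality \<open>le\<close> again,
      applied to the scalar \<open>inverse c\<close> and the functional \<open>c\<close> times
      \<phi>.\<close>
    show "norm c * vnorm (dual E) \<phi> \<le> vnorm (dual E) (c \<odot>\<^bsub>dual E\<^esub> \<phi>)"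
    proof (cases "c = 0")
      case True
      then show ?thesis
        using vnorm_dual_upper[OF dual_smult_closed[OF \<phi>, of c], of \<zero>] by simp
    next
      case False
      have "inverse c \<odot>\<^bsub>dual E\<^esub> (c \<odot>\<^bsub>dual E\<^esub> \<phi>) = \<phi>"
        using False dual_extensional[OF \<phi>] by (intro extensionalityI[where A = "carrier E"]) auto
      then show ?thesis
        using le[OF dual_smult_closed[OF \<phi>, of c], of "inverse c"] False
        by (simp add: norm_divide field_simps)
    qed
  qed (rule le[OF \<phi>])
  assume \<psi>: "\<psi> \<in> carrier (dual E)"
  show "vnorm (dual E) (\<phi> \<oplus>\<^bsub>dual E\<^esub> \<psi>) \<le> vnorm (dual E) \<phi> + vnorm (dual E) \<psi>"
    using vnorm_dual_upper[OF \<phi>] vnorm_dual_upper[OF \<psi>]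
    by (intro vnorm_dual_le) (auto intro: norm_triangle_le add_mono)
qed

section \<open>Weak convergence in the dual and norm convergence\<close>

text \<open>This is the canonical map into the bidual; the operator norm inequality, read with
  \<phi> as the variable, is the required bound.\<close>

lemma evaluation_in_bidual:
  assumes "x \<in> carrier E"
  shows "(\<lambda>\<phi>\<in>carrier (dual E). \<phi> x) \<in> carrier (dual (dual E))"
proof -
  interpret D: normed_space "dual E"
    by (rule normed_space_dual)
  have "norm (\<phi> x) \<le> (2 * vnorm E x) * vnorm (dual E) \<phi>" if "\<phi> \<in> carrier (dual E)" for \<phi>
    using norm_le_vnorm_dual[OF that assms] by (simp add: mult_ac)
  moreover have "linear_functional (dual E) (\<lambda>\<phi>\<in>carrier (dual E). \<phi> x)"
    unfolding linear_functional_def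
    using dual_add_closed dual_smult_closed assms by auto
  ultimately show ?thesis
    by (auto simp: D.carrier_dual_iff_bounded)
qed

text \<open>Weak convergence in the dual is tested against the whole bidual, hence against
  evaluations at points of \<open>E\<close>.\<close>

lemma weakly_converges_dual_pointwise:
  assumes "weakly_converges (dual E) f \<phi>" "x \<in> carrier E"
  shows "(\<lambda>j. f j x) \<longlonglongrightarrow> \<phi> x"
  using assms(1) evaluation_in_bidual[OF assms(2)] by (force simp: weakly_converges_def)

lemma topspace_norm_topology: "topspace (norm_topology E) = carrier E"
  by (simp add: norm_topology_def)

lemma limitin_norm_topology_iff:
  "limitin (norm_topology E) x a sequentially \<longleftrightarrow>
     a \<in> carrier E \<and> (\<forall>\<^sub>F j in sequentially. x j \<in> carrier E) \<and> (\<lambda>j. vdist E (x j) a) \<longlonglongrightarrow> 0"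
  unfolding norm_topology_def by (simp add: metric.limitin_metric_dist_null)

text \<open>\<open>Schur_property\<close> only yields some norm limit \<open>b\<close>, not tied to
  \<open>a\<close>. Interleaving with the constant \<open>a\<close> forces
  \<open>b = a\<close>.\<close>

lemma Schur_imp_limitin:
  assumes "Schur_property E" and x: "weakly_converges E x a"
  shows "limitin (norm_topology E) x a sequentially"
proof -
  define y where "y n = (if even n then x (n div 2) else a)" for n
  have carrier: "x j \<in> carrier E" "a \<in> carrier E" for j
    using x by (auto simp: weakly_converges_def)
  have half: "filterlim (\<lambda>n::nat. n div 2) at_top at_top"
    unfolding filterlim_at_top by (metis eventually_at_top_linorder div_le_mono nonzero_mult_div_cancel_left zero_neq_numeral)
  have "(\<lambda>n. \<phi> (y n)) \<longlonglongrightarrow> \<phi> a" if "\<phi> \<in> carrier (dual E)" for \<phi>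
  \<comment> \<open>At even \<open>n\<close> the distances of \<open>\<phi> (y n)\<close> and
    \<open>\<phi> (x (n div 2))\<close> from \<open>\<phi> a\<close> agree; at odd \<open>n\<close>
    the first is zero. So the first sequence is dominated by the second.\<close>
  proof (rule metric_tendsto_imp_tendsto)
    show "(\<lambda>n. \<phi> (x (n div 2))) \<longlonglongrightarrow> \<phi> a"
      using x that by (intro filterlim_compose[OF _ half]) (simp add: weakly_converges_def)
  qed (simp add: y_def)
  then have "weakly_converges E y a"
    using carrier by (simp add: weakly_converges_def y_def)
  then obtain b where b: "b \<in> carrier E" and lim: "(\<lambda>n. vnorm E (y n \<ominus> b)) \<longlonglongrightarrow> 0"
    using assms(1) by (auto simp: Schur_property_def)
  \<comment> \<open>The odd terms are constantly \<open>a\<close>, so the norm of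
    \<open>a \<ominus> b\<close> is the limit of a constant sequence.\<close>
  have "(\<lambda>n. vnorm E (y (2 * n + 1) \<ominus> b)) \<longlonglongrightarrow> 0"
    by (rule LIMSEQ_subseq_LIMSEQ[OF lim, of "\<lambda>n. 2 * n + 1", unfolded comp_def])
      (simp add: strict_mono_def)
  then have "vnorm E (a \<ominus> b) = 0"
    by (simp add: y_def LIMSEQ_const_iff)
  then have "a = b"
    using b carrier by (simp add: diff_zero_iff)
  moreover have "(\<lambda>n. vnorm E (y (2 * n) \<ominus> b)) \<longlonglongrightarrow> 0"
    by (rule LIMSEQ_subseq_LIMSEQ[OF lim, of "\<lambda>n. 2 * n", unfolded comp_def])
      (simp add: strict_mono_def)
  ultimately show ?thesis
    using carrier by (simp add: y_def limitin_norm_topology_iff vdist_def)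
qed

end

section \<open>Uniform boundedness\<close>

text \<open>Baire category: the closed sets on which all \<open>f j\<close> are bounded by
  \<open>n\<close> cover the complete space, so one of them contains a ball. Linearity moves that
  ball to the origin.\<close>

lemma (in Banach_space) Banach_Steinhaus:
  assumes f: "\<And>j::nat. f j \<in> carrier (dual E)"
    and bounded: "\<And>x. x \<in> carrier E \<Longrightarrow> bounded (range (\<lambda>j. f j x))"
  obtains K where "\<And>j x. x \<in> carrier E \<Longrightarrow> norm (f j x) \<le> K * vnorm E x"
proof -
  define A where "A n = {x \<in> carrier E. \<forall>j. norm (f j x) \<le> real n}" for n
  have lin: "linear_functional E (f j)" for j
    using f by (simp add: carrier_dual_iff)
  have closed: "closedin metric.mtopology (A n)" for n
  proof -
    have "closedin metric.mtopology {x \<in> topspace metric.mtopology. f j x \<in> cball 0 (real n)}" for j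
      using f[of j] by (intro closedin_continuous_map_preimage[where Y = euclidean])
        (auto simp: carrier_dual_iff norm_topology_def)
    then have "closedin metric.mtopology
        (\<Inter>j. {x \<in> topspace metric.mtopology. f j x \<in> cball 0 (real n)})"
      by (intro closedin_Inter) auto
    also have "(\<Inter>j. {x \<in> topspace metric.mtopology. f j x \<in> cball 0 (real n)}) = A n"
      by (auto simp: A_def)
    finally show ?thesis .
  qed
  have cover: "\<Union> (range A) = carrier E"
  proof -
    have "\<exists>n. x \<in> A n" if x: "x \<in> carrier E" for x
    proof -
      obtain B where "\<And>j. norm (f j x) \<le> B"
        using bounded[OF x] by (auto simp: bounded_iff)
      moreover obtain n where "B \<le> real n"
        using real_arch_simple by blast
      ultimately show ?thesis
        using x by (auto simp: A_def intro: order_trans)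
    qed
    then show ?thesis
      by (auto simp: A_def)
  qed
  \<comment> \<open>Otherwise the union of the \<open>A n\<close>, which is the whole space, would
    have empty interior; but the space is open in itself and contains zero.\<close>
  have "\<exists>n. metric.mtopology interior_of A n \<noteq> {}"
  proof (rule ccontr)
    assume "\<not> ?thesis"
    then have "metric.mtopology interior_of \<Union> (range A) = {}"
      using closed by (intro metric.metric_Baire_category_alt[OF complete]) auto
    then show False
      unfolding cover using interior_of_topspace[of metric.mtopology] by auto
  qed
  then obtain n x0 where "x0 \<in> metric.mtopology interior_of A n"
    by blast
  then obtain r where x0: "x0 \<in> carrier E" and "0 < r" and r: "metric.mball x0 r \<subseteq> A n"
    by (auto simp: metric.in_interior_of_mball)
  \<comment> \<open>Write \<open>y\<close> as the difference of \<open>x0 \<oplus> y\<close> and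
    \<open>x0\<close>. Both lie in the ball around \<open>x0\<close>, so each contributes at most
    \<open>n\<close>.\<close>
  have "norm (f j y) \<le> 2 * real n" if y: "y \<in> carrier E" "vnorm E y < r" for j y
  proof -
    have "x0 \<oplus> y \<ominus> x0 = y"
      using x0 y by (simp add: M.minus_eq M.a_comm[of x0] M.a_assoc M.r_neg)
    then have "vdist E x0 (x0 \<oplus> y) < r"
      using x0 y metric.commute[of x0 "x0 \<oplus> y"] by (simp add: vdist_def)
    then have "x0 \<oplus> y \<in> A n" "x0 \<in> A n"
      using r x0 y \<open>0 < r\<close> by auto
    then have "norm (f j (x0 \<oplus> y)) \<le> real n" "norm (f j x0) \<le> real n"
      by (auto simp: A_def)
    moreover have "f j y = f j (x0 \<oplus> y) - f j x0"
      using x0 y by (simp add: linear_functionalD[OF lin])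
    ultimately show ?thesis
      using norm_triangle_ineq4[of "f j (x0 \<oplus> y)" "f j x0"] by simp
  qed
  \<comment> \<open>Neither \<open>r\<close> nor \<open>n\<close> depends on \<open>j\<close>, so
    the rescaling bound has the same constant for all \<open>f j\<close>.\<close>
  then show ?thesis
    using that linear_functional_bound[OF lin \<open>0 < r\<close>] by blast
qed

section \<open>Continuous multilinear maps on Schur spaces\<close>

lemma continuous_multilinear_WDP_at_every_point:
  fixes E :: "nat \<Rightarrow> ('k::real_normed_field, 'a) nspace"
    and F :: "('k, 'b) nspace"
  assumes E: "\<And>i. i \<in> {1..m} \<Longrightarrow> normed_space (E i)"
    and Schur: "\<And>i. i \<in> {1..m} \<Longrightarrow> Schur_property (E i)"
    and "Banach_space F"
    and T: "T \<in> continuous_multilinear_maps m E F"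
  shows "WDP_at_every_point m E F T"
  unfolding WDP_at_every_point_def
proof (intro ballI allI impI)
  interpret F: Banach_space F
    by fact
  fix a x f \<phi>
  assume a: "a \<in> (\<Pi>\<^sub>E i\<in>{1..m}. carrier (E i))"
    and x: "\<forall>i\<in>{1..m}. weakly_converges (E i) (x i) (a i)"
    and f: "weakly_converges (dual F) f \<phi>"
  define y where "y j = T (\<lambda>i\<in>{1..m}. x i j)" for j
  have f_dual: "f j \<in> carrier (dual F)" for j
    using f by (simp add: weakly_converges_def)
  have f_lim: "(\<lambda>j. f j z) \<longlonglongrightarrow> \<phi> z" if "z \<in> carrier F" for z
    using F.weakly_converges_dual_pointwise[OF f that] .
  \<comment> \<open>The sequence \<open>f\<close> converges at each point, so it is pointwise
    bounded.\<close>
  obtain K where K: "\<And>j z. z \<in> carrier F \<Longrightarrow> norm (f j z) \<le> K * vnorm F z"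
    using F.Banach_Steinhaus[of f] f_dual f_lim
    by (metis convergent_imp_bounded)
  have x_lim: "limitin (norm_topology (E i)) (x i) (a i) sequentially" if "i \<in> {1..m}" for i
    using normed_space.Schur_imp_limitin[OF E Schur] x that by blast
  have "x i j \<in> topspace (norm_topology (E i))" if "i \<in> {1..m}" for i j
    using x that normed_space.topspace_norm_topology[OF E] by (simp add: weakly_converges_def)
  \<comment> \<open>Convergence in the product topology is componentwise, so the norm limits of the
    coordinates suffice, and continuity of \<open>T\<close> then carries the limit to
    \<open>F\<close>.\<close>
  then have "limitin (product_topology (\<lambda>i. norm_topology (E i)) {1..m})
      (\<lambda>j. \<lambda>i\<in>{1..m}. x i j) a sequentially"
    using a x_lim by (auto simp: limitin_componentwise PiE_def)
  from continuous_map_limit[OF _ this, of "norm_topology F" T]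
  have "limitin (norm_topology F) y (T a) sequentially"
    using T by (simp add: continuous_multilinear_maps_def comp_def y_def[abs_def])
  moreover have y: "y j \<in> carrier F" for j
  proof -
    have "(\<lambda>i\<in>{1..m}. x i j) \<in> (\<Pi>\<^sub>E i\<in>{1..m}. carrier (E i))"
      using x by (auto simp: weakly_converges_def)
    moreover have "T \<in> (\<Pi>\<^sub>E i\<in>{1..m}. carrier (E i)) \<rightarrow>\<^sub>E carrier F"
      using T by (simp add: continuous_multilinear_maps_def multilinear_maps_def)
    ultimately show ?thesis
      unfolding y_def by (rule PiE_mem[rotated])
  qed
  ultimately have Ta: "T a \<in> carrier F" and lim: "(\<lambda>j. vnorm F (y j \<ominus>\<^bsub>F\<^esub> T a)) \<longlonglongrightarrow> 0"
    by (auto simp: F.limitin_norm_topology_iff vdist_def)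
  \<comment> \<open>The functional and its argument both vary with \<open>j\<close>; the uniform
    \<open>K\<close> reduces the claim to the norm convergence \<open>lim\<close>.\<close>
  have "(\<lambda>j. f j (y j \<ominus>\<^bsub>F\<^esub> T a)) \<longlonglongrightarrow> 0"
    using K y Ta by (intro Lim_null_comparison[OF _ tendsto_mult_right_zero[OF lim, of K]]) simp
  from tendsto_add[OF this f_lim[OF Ta]] show "(\<lambda>j. f j (T (\<lambda>i\<in>{1..m}. x i j))) \<longlonglongrightarrow> \<phi> (T a)"
    using f_dual y Ta by (simp add: F.linear_functional_diff carrier_dual_iff y_def)
qed

theorem proposition3p19:
  fixes m :: nat
    and E :: "nat \<Rightarrow> ('k::real_normed_field, 'a) nspace"
    and F :: "('k, 'b) nspace"
  assumes "1 \<le> m"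
    and "\<And>i. i \<in> {1..m} \<Longrightarrow> Banach_space (E i)"
    and "Banach_space F"
    and "\<And>i. i \<in> {1..m} \<Longrightarrow> Schur_property (E i)"
  shows "(\<forall>T \<in> continuous_multilinear_maps m E F. WDP_at_every_point m E F T) \<and>
         WDP_ev m E F = continuous_multilinear_maps m E F"
proof -
  have "\<forall>T \<in> continuous_multilinear_maps m E F. WDP_at_every_point m E F T"
    using continuous_multilinear_WDP_at_every_point[of m E F] Banach_space.axioms(1) assms
    by blast
  then show ?thesis
    by (auto simp: WDP_ev_def)
qed

end
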